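(* For every odd prime $p$, there exists a finite solvable group $G$ with $\sigma_2(G)=1+p^2+p^3+p^4$.
   Context: A 2-covering of a finite group $G$ is a set of proper subgroups of $G$ such that every pair of elements of $G$ is contained in at least one subgroup in the set. A finite group admits a 2-covering if and only if it cannot be generated by two elements. For such $G$, $\sigma_2(G)$ (the 2-covering number) denotes the smallest size of a 2-covering of $G$. *)

theory Defs
  imports "HOL-Algebra.Algebra"
begin

definition two_covering :: "('a, 'b) monoid_scheme \<Rightarrow> 'a set set \<Rightarrow> bool" where
  "two_covering G C \<longleftrightarrow>
     (\<forall>H\<in>C. subgroup H G \<and> H \<noteq> carrier G) \<and>
     (\<forall>x\<in>carrier G. \<forall>y\<in>carrier G. \<exists>H\<in>C. x \<in> H \<and> y \<in> H)"

definition sigma2 :: "('a, 'b) monoid_scheme \<Rightarrow> nat" where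
  "sigma2 G = (LEAST n. \<exists>C. two_covering G C \<and> finite C \<and> card C = n)"

end

theory Submission
  imports Defs "HOL-Library.Product_Plus"
begin

text \<open>
  Choose \<open>a\<close>, \<open>b\<close> with \<open>a\<^sup>2 + b\<^sup>2 = - 1\<close> modulo \<open>p\<close>; this embeds the quaternion group \<open>Q\<close> of order 8
  irreducibly into \<open>SL(2, p)\<close>. Let \<open>G\<close> be the semidirect product of the \<open>2 \<times> 3\<close> matrices over the
  field \<open>F\<close> with \<open>p\<close> elements by \<open>Q\<close>, acting by left multiplication. For a point \<open>l\<close> of the projective
  plane and \<open>v\<close> in \<open>F\<^sup>2\<close> the pairs \<open>(A, h)\<close> with \<open>A l = v - h v\<close> form a maximal subgroup \<open>M l v\<close>
  which is generated by two elements, so all \<open>p\<^sup>2 (1 + p + p\<^sup>2)\<close> of them belong to every 2-covering. No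
  \<open>M l v\<close> contains two translations whose rows together span \<open>F\<^sup>3\<close>, so one more subgroup is needed.
  Conversely, \<open>1 - h\<close> is invertible for every nontrivial \<open>h\<close> in \<open>Q\<close>. For elements \<open>(A, h)\<close> and \<open>(B, k)\<close>
  with \<open>h\<close> nontrivial, any \<open>l\<close> in the kernel of the \<open>2 \<times> 3\<close> matrix \<open>B - (1 - k) (1 - h)\<^sup>-\<^sup>1 A\<close> gives an
  \<open>M l v\<close> containing both, and the pairs of translations are covered by the group of all translations.
\<close>

section \<open>Matrices acting on pairs of rows\<close>

type_synonym 'r row = "'r \<times> 'r \<times> 'r"
text \<open>Entries are listed row by row: \<open>(a, b, c, d)\<close> has the rows
  \<open>(a, b)\<close> and \<open>(c, d)\<close>. A 2 by 3 matrix is a pair of values of type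
  \<open>'r row\<close>.\<close>

type_synonym 'r mat2 = "'r \<times> 'r \<times> 'r \<times> 'r"

fun scale_row :: "'r::comm_ring_1 \<Rightarrow> 'r row \<Rightarrow> 'r row" where
  "scale_row c (x, y, z) = (c * x, c * y, c * z)"

fun dot :: "'r::comm_ring_1 row \<Rightarrow> 'r row \<Rightarrow> 'r" where
  "dot (x, y, z) (x', y', z') = x * x' + y * y' + z * z'"

fun mat2_mult :: "'r::comm_ring_1 mat2 \<Rightarrow> 'r mat2 \<Rightarrow> 'r mat2" where
  "mat2_mult (a, b, c, d) (a', b', c', d') =
     (a * a' + b * c', a * b' + b * d', c * a' + d * c', c * b' + d * d')"

fun act_rows :: "'r::comm_ring_1 mat2 \<Rightarrow> 'r row \<times> 'r row \<Rightarrow> 'r row \<times> 'r row" where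
  "act_rows (a, b, c, d) (u, w) =
     (scale_row a u + scale_row b w, scale_row c u + scale_row d w)"

fun act_col :: "'r::comm_ring_1 mat2 \<Rightarrow> 'r \<times> 'r \<Rightarrow> 'r \<times> 'r" where
  "act_col (a, b, c, d) (x, y) = (a * x + b * y, c * x + d * y)"

fun mult_col :: "'r row \<times> 'r row \<Rightarrow> 'r::comm_ring_1 row \<Rightarrow> 'r \<times> 'r" where
  "mult_col (u, w) l = (dot u l, dot w l)"

text \<open>For a matrix of determinant \<open>e\<close> this is the inverse, written without
  division.\<close>

fun adjugate :: "'r::comm_ring_1 mat2 \<Rightarrow> 'r mat2" where
  "adjugate (a, b, c, d) = (d, -b, -c, a)"

lemma dot_add: "dot (u + w) l = dot u l + dot w l"
  by (cases u; cases w; cases l) (simp add: algebra_simps)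

lemma dot_diff: "dot (u - w) l = dot u l - dot w l"
  by (cases u; cases w; cases l) (simp add: algebra_simps)

lemma dot_scale_row: "dot (scale_row c u) l = c * dot u l"
  by (cases u; cases l) (simp add: algebra_simps)

lemma scale_row_add: "scale_row c (u + w) = scale_row c u + scale_row c w"
  by (cases u; cases w) (simp add: algebra_simps)

lemma mat2_mult_assoc: "mat2_mult (mat2_mult g h) k = mat2_mult g (mat2_mult h k)"
  by (cases g; cases h; cases k) (simp add: algebra_simps)

lemma scale_row_add_left: "scale_row (c + d) u = scale_row c u + scale_row d u"
  by (cases u) (simp add: algebra_simps)

lemma scale_row_scale_row: "scale_row c (scale_row d u) = scale_row (c * d) u"
  by (cases u) (simp add: algebra_simps)

lemma act_rows_mult: "act_rows (mat2_mult g h) A = act_rows g (act_rows h A)"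
  by (cases g; cases h; cases A)
    (simp add: scale_row_add scale_row_add_left scale_row_scale_row algebra_simps)

lemma act_rows_add: "act_rows h (A + B) = act_rows h A + act_rows h B"
  by (cases h; cases A; cases B) (simp add: scale_row_add algebra_simps)

lemma act_rows_uminus: "act_rows h (- A) = - act_rows h A"
proof -
  have "act_rows h (- A) + act_rows h A = act_rows h 0"
    by (simp flip: act_rows_add)
  also have "\<dots> = 0"
    by (cases h) (simp add: zero_prod_def)
  finally show ?thesis
    by (simp add: eq_neg_iff_add_eq_0)
qed

lemma act_rows_diff: "act_rows h (A - B) = act_rows h A - act_rows h B"
  using act_rows_add[of h A "- B"] by (simp add: act_rows_uminus)

lemma act_col_mult: "act_col (mat2_mult g h) v = act_col g (act_col h v)"
  by (cases g; cases h; cases v) (simp add: algebra_simps)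

lemma act_col_diff: "act_col h (v - w) = act_col h v - act_col h w"
  by (cases h; cases v; cases w) (simp add: algebra_simps)

lemma mult_col_add: "mult_col (A + B) l = mult_col A l + mult_col B l"
  by (cases A; cases B; cases l) (simp add: dot_add algebra_simps)

lemma mult_col_diff: "mult_col (A - B) l = mult_col A l - mult_col B l"
  by (cases A; cases B; cases l) (simp add: dot_diff algebra_simps)

lemma mult_col_act_rows: "mult_col (act_rows h A) l = act_col h (mult_col A l)"
  by (cases h; cases A; cases l) (simp add: dot_add dot_scale_row algebra_simps)

section \<open>The semidirect product\<close>

text \<open>All prime fields are realised inside one type of class \<open>comm_ring_1\<close>, as subrings \<open>F\<close> whose
  unit \<open>e\<close> is an idempotent different from 1.\<close>

locale quaternion_field =
  fixes F :: "'r::comm_ring_1 set" and e a b :: 'r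
  assumes finite_F: "finite F"
    and zero_F [simp]: "0 \<in> F"
    and add_F [simp]: "\<And>x y. x \<in> F \<Longrightarrow> y \<in> F \<Longrightarrow> x + y \<in> F"
    and uminus_F [simp]: "\<And>x. x \<in> F \<Longrightarrow> - x \<in> F"
    and mult_F [simp]: "\<And>x y. x \<in> F \<Longrightarrow> y \<in> F \<Longrightarrow> x * y \<in> F"
    and e_F [simp]: "e \<in> F"
    and e_mult [simp]: "\<And>x. x \<in> F \<Longrightarrow> e * x = x"
    and inverse_F: "\<And>x. x \<in> F \<Longrightarrow> x \<noteq> 0 \<Longrightarrow> \<exists>y\<in>F. x * y = e"
    and prime_F: "\<And>x. x \<in> F \<Longrightarrow> \<exists>n. x = of_nat n * e"
    and two_e: "e + e \<noteq> 0"
    and a_F [simp]: "a \<in> F" and b_F [simp]: "b \<in> F"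
    and sum_squares: "a * a + b * b = - e"
begin

lemma mult_e [simp]: "x \<in> F \<Longrightarrow> x * e = x"
  using e_mult[of x] by (simp add: mult.commute)

lemma diff_F [simp]: "x \<in> F \<Longrightarrow> y \<in> F \<Longrightarrow> x - y \<in> F"
  using add_F[of x "- y"] by simp

lemma e_nonzero [simp]: "e \<noteq> 0"
  using two_e by auto

text \<open>The ambient ring may have zero divisors, so integrality is derived from inverses
  relative to \<open>e\<close>: multiply \<open>x * y = 0\<close> by the inverse of
  \<open>y\<close>.\<close>

lemma integral_F:
  assumes "x \<in> F" "y \<in> F" "x * y = 0"
  shows "x = 0 \<or> y = 0"
proof (rule disjCI)
  assume "y \<noteq> 0"
  then obtain z where "y * z = e"
    using inverse_F assms by blast
  then have "x * y * z = x"
    using assms(1) by (simp only: mult.assoc mult_e)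
  then show "x = 0"
    using assms by (metis mult_zero_left)
qed

lemma double_F:
  assumes "x \<in> F" "x + x = 0"
  shows "x = 0"
proof -
  have "(e + e) * x = 0"
    using assms by (simp only: distrib_right e_mult)
  then show ?thesis
    using integral_F[OF add_F[OF e_F e_F] assms(1)] two_e by blast
qed

definition rows :: "'r row set" where
  "rows = F \<times> F \<times> F"

section \<open>The quaternion group and the semidirect product\<close>

definition q1 :: "'r mat2" where "q1 = (e, 0, 0, e)"
definition qm :: "'r mat2" where "qm = (- e, 0, 0, - e)"
definition qi :: "'r mat2" where "qi = (0, - e, e, 0)"
text \<open>The sum of squares enters here: \<open>qj\<close> has trace 0 and determinant
  \<open>- (a * a + b * b) = e\<close>, so its square is \<open>qm\<close>. Moreover it anticommutes
  with \<open>qi\<close>.\<close>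

definition qj :: "'r mat2" where "qj = (a, b, b, - a)"

definition Q8 :: "'r mat2 set" where
  "Q8 = {q1, qm, qi, mat2_mult qm qi, qj, mat2_mult qm qj,
     mat2_mult qi qj, mat2_mult qm (mat2_mult qi qj)}"

abbreviation matrices :: "('r row \<times> 'r row) set" where
  "matrices \<equiv> rows \<times> rows"

definition G :: "(('r row \<times> 'r row) \<times> 'r mat2) monoid" where
  "G = \<lparr>carrier = matrices \<times> Q8,
        monoid.mult = \<lambda>x y. (fst x + act_rows (snd x) (fst y), mat2_mult (snd x) (snd y)),
        one = (0, q1)\<rparr>"

lemmas q_defs = q1_def qm_def qi_def qj_def

lemma aa: "a * a = - e - b * b"
  using sum_squares by (simp add: algebra_simps)

text \<open>Companion of \<open>aa\<close> for right-nested products, in which \<open>a * a\<close>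
  is not a subterm; together the two rules eliminate squares of \<open>a\<close> after
  \<open>algebra_simps\<close>.\<close>

lemma abs_aa: "a * (a * x) = - e * x - b * (b * x)"
proof -
  have "a * (a * x) = (a * a) * x" by (simp add: mult.assoc)
  then show ?thesis by (simp only: aa) (simp add: algebra_simps)
qed

lemma Q8_eq: "Q8 = {(e, 0, 0, e), (- e, 0, 0, - e), (0, - e, e, 0), (0, e, - e, 0),
    (a, b, b, - a), (- a, - b, - b, a), (- b, a, a, b), (b, - a, - a, - b)}"
  by (simp add: Q8_def q_defs)

lemma Q8_generators_mult:
  assumes "h \<in> Q8"
  shows "mat2_mult qm h \<in> Q8" "mat2_mult qi h \<in> Q8" "mat2_mult qj h \<in> Q8"
  using assms unfolding Q8_eq qm_def qi_def qj_def
  by (elim insertE emptyE; simp add: aa mult.commute[of b a])+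

text \<open>\<open>Q8\<close> is defined by words in \<open>qm\<close>, \<open>qi\<close>,
  \<open>qj\<close>, so closure under left multiplication by these three and associativity suffice;
  this takes 24 products instead of 64.\<close>

lemma Q8_mult:
  assumes "g \<in> Q8" "h \<in> Q8"
  shows "mat2_mult g h \<in> Q8"
proof -
  have q1: "mat2_mult q1 h = h"
    using assms(2) unfolding Q8_eq q1_def by (elim insertE emptyE; simp)
  show ?thesis
    using assms(1) Q8_generators_mult assms(2) q1 unfolding Q8_def[THEN eqset_imp_iff, of g]
    by (elim insertE emptyE; simp add: mat2_mult_assoc)
qed

lemma Q8_F: "(x, y, z, w) \<in> Q8 \<Longrightarrow> x \<in> F \<and> y \<in> F \<and> z \<in> F \<and> w \<in> F"
  unfolding Q8_eq by (elim insertE emptyE; simp)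

lemma Q8_det: "(x, y, z, w) \<in> Q8 \<Longrightarrow> x * w - y * z = e"
  unfolding Q8_eq by (elim insertE emptyE; simp add: aa)

lemma Q8_adjugate: "h \<in> Q8 \<Longrightarrow> adjugate h \<in> Q8"
  unfolding Q8_eq by (elim insertE emptyE; simp)

text \<open>The six elements of order 4 have trace 0, and \<open>qm\<close> has trace -2. Since the
  determinant of 1 - h is 2 minus the trace of h, this is what makes 1 - h invertible.\<close>

lemma Q8_trace: "(x, y, z, w) \<in> Q8 \<Longrightarrow> (x, y, z, w) \<noteq> q1 \<Longrightarrow> x + w = 0 \<or> x + w = - e - e"
  unfolding Q8_eq q1_def by (elim insertE emptyE; simp)

lemma mult_q1: "h \<in> Q8 \<Longrightarrow> mat2_mult q1 h = h" "h \<in> Q8 \<Longrightarrow> mat2_mult h q1 = h"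
  unfolding Q8_eq q1_def by (elim insertE emptyE; simp)+

lemma mult_adjugate:
  assumes "h \<in> Q8"
  shows "mat2_mult (adjugate h) h = q1" "mat2_mult h (adjugate h) = q1"
proof -
  obtain x y z w where "h = (x, y, z, w)" by (cases h)
  then show "mat2_mult (adjugate h) h = q1" "mat2_mult h (adjugate h) = q1"
    using Q8_det[of x y z w] assms by (simp_all add: q1_def algebra_simps)
qed

lemma q_in_Q8 [simp]: "q1 \<in> Q8" "qm \<in> Q8" "qi \<in> Q8" "qj \<in> Q8"
  by (simp_all add: Q8_def)

lemma zero_matrices [simp]: "0 \<in> rows" "0 \<in> matrices"
  by (simp_all add: rows_def zero_prod_def)

lemma rows_diff: "u \<in> rows \<Longrightarrow> w \<in> rows \<Longrightarrow> u - w \<in> rows"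
  by (auto simp: rows_def)

lemma rows_scale: "c \<in> F \<Longrightarrow> u \<in> rows \<Longrightarrow> scale_row c u \<in> rows"
  by (auto simp: rows_def)

lemma scale_row_e: "u \<in> rows \<Longrightarrow> scale_row e u = u"
  by (auto simp: rows_def)

lemma dot_F: "u \<in> rows \<Longrightarrow> l \<in> rows \<Longrightarrow> dot u l \<in> F"
  by (auto simp: rows_def)

lemma matrices_add: "A \<in> matrices \<Longrightarrow> B \<in> matrices \<Longrightarrow> A + B \<in> matrices"
  by (auto simp: rows_def)

lemma matrices_diff: "A \<in> matrices \<Longrightarrow> B \<in> matrices \<Longrightarrow> A - B \<in> matrices"
  by (auto simp: rows_def)

lemma matrices_uminus: "A \<in> matrices \<Longrightarrow> - A \<in> matrices"
  using matrices_diff[of 0 A] by simp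

lemma matrices_act: "h \<in> F \<times> F \<times> F \<times> F \<Longrightarrow> A \<in> matrices \<Longrightarrow> act_rows h A \<in> matrices"
  by (auto simp: rows_def)

lemma Q8_subset: "h \<in> Q8 \<Longrightarrow> h \<in> F \<times> F \<times> F \<times> F"
  using Q8_F by (cases h) auto

lemma matrices_act_Q8: "h \<in> Q8 \<Longrightarrow> A \<in> matrices \<Longrightarrow> act_rows h A \<in> matrices"
  using matrices_act Q8_subset by blast

lemma act_rows_q1: "A \<in> matrices \<Longrightarrow> act_rows q1 A = A"
  by (auto simp: q1_def rows_def zero_prod_def)

lemma act_col_q1: "v \<in> F \<times> F \<Longrightarrow> act_col q1 v = v"
  by (auto simp: q1_def)

lemma carrier_G: "carrier G = matrices \<times> Q8"
  by (simp add: G_def)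

lemma one_G: "\<one>\<^bsub>G\<^esub> = (0, q1)"
  by (simp add: G_def)

lemma mult_G: "(A, g) \<otimes>\<^bsub>G\<^esub> (B, h) = (A + act_rows g B, mat2_mult g h)"
  by (simp add: G_def)

lemma left_inverse_G:
  assumes "A \<in> matrices" "h \<in> Q8"
  shows "(- act_rows (adjugate h) A, adjugate h) \<in> carrier G"
    and "(- act_rows (adjugate h) A, adjugate h) \<otimes>\<^bsub>G\<^esub> (A, h) = \<one>\<^bsub>G\<^esub>"
proof -
  show "(- act_rows (adjugate h) A, adjugate h) \<in> carrier G"
    unfolding carrier_G
    using assms by (intro SigmaI matrices_uminus matrices_act_Q8 Q8_adjugate)
  show "(- act_rows (adjugate h) A, adjugate h) \<otimes>\<^bsub>G\<^esub> (A, h) = \<one>\<^bsub>G\<^esub>"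
    using assms by (simp add: mult_G one_G mult_adjugate)
qed

lemma group_G: "group G"
proof (rule groupI)
  fix x y assume "x \<in> carrier G" "y \<in> carrier G"
  then show "x \<otimes>\<^bsub>G\<^esub> y \<in> carrier G"
    using matrices_add matrices_act_Q8 Q8_mult by (cases x; cases y) (metis carrier_G mem_Sigma_iff mult_G)
next
  show "\<one>\<^bsub>G\<^esub> \<in> carrier G"
    by (simp add: carrier_G one_G)
next
  fix x y z
  show "x \<otimes>\<^bsub>G\<^esub> y \<otimes>\<^bsub>G\<^esub> z = x \<otimes>\<^bsub>G\<^esub> (y \<otimes>\<^bsub>G\<^esub> z)"
    by (cases x; cases y; cases z)
      (simp only: mult_G mat2_mult_assoc act_rows_mult act_rows_add add.assoc)
next
  fix x assume "x \<in> carrier G"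
  then show "\<one>\<^bsub>G\<^esub> \<otimes>\<^bsub>G\<^esub> x = x"
    by (cases x) (simp add: carrier_G one_G mult_G act_rows_q1 mult_q1)
next
  fix x assume "x \<in> carrier G"
  then show "\<exists>y\<in>carrier G. y \<otimes>\<^bsub>G\<^esub> x = \<one>\<^bsub>G\<^esub>"
    using left_inverse_G by (cases x) (metis carrier_G mem_Sigma_iff)
qed

lemma inv_G: "A \<in> matrices \<Longrightarrow> h \<in> Q8 \<Longrightarrow> inv\<^bsub>G\<^esub> (A, h) = (- act_rows (adjugate h) A, adjugate h)"
  by (rule group.inv_equality[OF group_G left_inverse_G(2) _ left_inverse_G(1)]) (simp_all only: carrier_G mem_Sigma_iff)

lemma finite_G: "finite (carrier G)"
  unfolding carrier_G rows_def Q8_def by (intro finite_cartesian_product finite_F finite.intros)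

text \<open>\<open>M l v\<close> is the stabiliser of \<open>v\<close> when \<open>(A, h)\<close> acts on \<open>F\<^sup>2\<close> by \<open>c \<mapsto> A l + h c\<close>.\<close>

definition M :: "'r row \<Rightarrow> 'r \<times> 'r \<Rightarrow> (('r row \<times> 'r row) \<times> 'r mat2) set" where
  "M l v = {(A, h). A \<in> matrices \<and> h \<in> Q8 \<and> mult_col A l = v - act_col h v}"

text \<open>Closure under products is the cocycle identity v - h k v = (v - h v) + h (v - k v); the
  inverse is treated by applying \<open>adjugate h\<close> to the defining equation.\<close>

lemma subgroup_M:
  assumes v: "v \<in> F \<times> F"
  shows "subgroup (M l v) G"
proof (rule group.subgroupI[OF group_G])
  show "M l v \<subseteq> carrier G"
    by (auto simp: M_def carrier_G)
  have "(0, q1) \<in> M l v"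
    by (cases l) (simp add: M_def act_col_q1 v zero_prod_def rows_def)
  then show "M l v \<noteq> {}"
    by blast
next
  fix x assume "x \<in> M l v"
  then obtain A h where x: "x = (A, h)" "A \<in> matrices" "h \<in> Q8" "mult_col A l = v - act_col h v"
    by (auto simp: M_def)
  have "mult_col (- act_rows (adjugate h) A) l = mult_col (0 - act_rows (adjugate h) A) l"
    by simp
  also have "\<dots> = mult_col 0 l - act_col (adjugate h) (v - act_col h v)"
    by (simp only: mult_col_diff mult_col_act_rows x(4))
  also have "mult_col 0 l = 0"
    by (cases l) (simp add: zero_prod_def)
  also have "0 - act_col (adjugate h) (v - act_col h v) = v - act_col (adjugate h) v"
    using act_col_q1[OF v] mult_adjugate[OF x(3)] by (simp add: act_col_diff flip: act_col_mult)
  finally have "mult_col (- act_rows (adjugate h) A) l = v - act_col (adjugate h) v" .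
  moreover have "- act_rows (adjugate h) A \<in> matrices" "adjugate h \<in> Q8"
    by (rule matrices_uminus[OF matrices_act_Q8[OF Q8_adjugate[OF x(3)] x(2)]] Q8_adjugate[OF x(3)])+
  ultimately show "inv\<^bsub>G\<^esub> x \<in> M l v"
    unfolding x(1) inv_G[OF x(2,3)] M_def by blast
next
  fix x y assume "x \<in> M l v" "y \<in> M l v"
  then obtain A h B k where x: "x = (A, h)" "A \<in> matrices" "h \<in> Q8" "mult_col A l = v - act_col h v"
    and y: "y = (B, k)" "B \<in> matrices" "k \<in> Q8" "mult_col B l = v - act_col k v"
    by (auto simp: M_def)
  have "mult_col (A + act_rows h B) l = v - act_col (mat2_mult h k) v"
    by (simp only: mult_col_add mult_col_act_rows x(4) y(4) act_col_diff act_col_mult) simp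
  moreover have "A + act_rows h B \<in> matrices" "mat2_mult h k \<in> Q8"
    by (rule matrices_add[OF x(2) matrices_act_Q8[OF x(3) y(2)]] Q8_mult[OF x(3) y(3)])+
  ultimately show "x \<otimes>\<^bsub>G\<^esub> y \<in> M l v"
    unfolding x(1) y(1) mult_G M_def by blast
qed

section \<open>Points of the projective plane over \<open>F\<close>\<close>

definition points :: "'r row set" where
  "points = (\<lambda>(x, y). (e, x, y)) ` (F \<times> F) \<union> (\<lambda>x. (0, e, x)) ` F \<union> {(0, 0, e)}"

text \<open>Each point is represented by its unique triple whose first nonzero coordinate is
  \<open>e\<close>; the cases are the affine chart, the line at infinity without one point, and that
  point.\<close>

lemma points_cases [consumes 1, case_names affine line infinity]:
  assumes "l \<in> points"
  obtains x y where "l = (e, x, y)" "x \<in> F" "y \<in> F"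
    | x where "l = (0, e, x)" "x \<in> F"
    | "l = (0, 0, e)"
  using assms by (auto simp: points_def)

lemma points_rows: "points \<subseteq> rows"
  by (auto simp: points_def rows_def)

text \<open>The rows \<open>w1\<close>, \<open>w2\<close> span the annihilator of \<open>l\<close>,
  and \<open>t\<close> completes them to a basis of F^3. Later \<open>t\<close> yields matrices with
  a prescribed product with \<open>l\<close>, and \<open>w1\<close>, \<open>w2\<close> yield the
  translations in \<open>M l v\<close>.\<close>

lemma point_dual_basis:
  assumes "l \<in> points"
  obtains t w1 w2 where "t \<in> rows" "w1 \<in> rows" "w2 \<in> rows"
    "dot t l = e" "dot w1 l = 0" "dot w2 l = 0"
    "\<And>u. u \<in> rows \<Longrightarrow> dot u l = 0 \<Longrightarrow> \<exists>c\<in>F. \<exists>d\<in>F. u = scale_row c w1 + scale_row d w2"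
  using assms
proof (cases rule: points_cases)
  case (affine x y)
  have "\<exists>c\<in>F. \<exists>d\<in>F. u = scale_row c (- x, e, 0) + scale_row d (- y, 0, e)"
    if "u \<in> rows" "dot u l = 0" for u
  proof -
    obtain u1 u2 u3 where u: "u = (u1, u2, u3)" "u1 \<in> F" "u2 \<in> F" "u3 \<in> F"
      using \<open>u \<in> rows\<close> by (auto simp: rows_def)
    have "u1 = - (u2 * x) - u3 * y"
      using that(2) u affine by (simp add: algebra_simps eq_neg_iff_add_eq_0)
    then have "u = scale_row u2 (- x, e, 0) + scale_row u3 (- y, 0, e)"
      using u by simp
    then show ?thesis
      using u by blast
  qed
  then show ?thesis
    using affine by (intro that[of "(e, 0, 0)" "(- x, e, 0)" "(- y, 0, e)"]) (simp_all add: rows_def)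
next
  case (line x)
  have "\<exists>c\<in>F. \<exists>d\<in>F. u = scale_row c (e, 0, 0) + scale_row d (0, - x, e)"
    if "u \<in> rows" "dot u l = 0" for u
  proof -
    obtain u1 u2 u3 where u: "u = (u1, u2, u3)" "u1 \<in> F" "u2 \<in> F" "u3 \<in> F"
      using \<open>u \<in> rows\<close> by (auto simp: rows_def)
    have "u2 = - (u3 * x)"
      using that(2) u line by (simp add: eq_neg_iff_add_eq_0)
    then have "u = scale_row u1 (e, 0, 0) + scale_row u3 (0, - x, e)"
      using u by simp
    then show ?thesis
      using u by blast
  qed
  then show ?thesis
    using line by (intro that[of "(0, e, 0)" "(e, 0, 0)" "(0, - x, e)"]) (simp_all add: rows_def)
next
  case infinity
  have "\<exists>c\<in>F. \<exists>d\<in>F. u = scale_row c (e, 0, 0) + scale_row d (0, e, 0)"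
    if "u \<in> rows" "dot u l = 0" for u
  proof -
    obtain u1 u2 u3 where u: "u = (u1, u2, u3)" "u1 \<in> F" "u2 \<in> F" "u3 \<in> F"
      using \<open>u \<in> rows\<close> by (auto simp: rows_def)
    then have "u = scale_row u1 (e, 0, 0) + scale_row u2 (0, e, 0)"
      using that(2) infinity by simp
    then show ?thesis
      using u by blast
  qed
  then show ?thesis
    using infinity by (intro that[of "(0, 0, e)" "(e, 0, 0)" "(0, e, 0)"]) (simp_all add: rows_def)
qed

text \<open>A projective point is determined by its annihilator. In each case the two rows tested
  span the annihilator of \<open>l\<close>, and normalisation turns proportionality into
  equality.\<close>

lemma point_eqI:
  assumes "l \<in> points" "l' \<in> points"
    and orth: "\<And>u. u \<in> rows \<Longrightarrow> dot u l = 0 \<Longrightarrow> dot u l' = 0"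
  shows "l = l'"
  using assms(1)
proof (cases rule: points_cases)
  case (affine x y)
  have "dot (- x, e, 0) l' = 0" "dot (- y, 0, e) l' = 0"
    using affine by (intro orth; simp add: rows_def)+
  with assms(2) affine show ?thesis
    by (cases rule: points_cases) simp_all
next
  case (line x)
  have "dot (e, 0, 0) l' = 0" "dot (0, - x, e) l' = 0"
    using line by (intro orth; simp add: rows_def)+
  with assms(2) line show ?thesis
    by (cases rule: points_cases) simp_all
next
  case infinity
  have "dot (e, 0, 0) l' = 0" "dot (0, e, 0) l' = 0"
    using infinity by (intro orth; simp add: rows_def)+
  with assms(2) infinity show ?thesis
    by (cases rule: points_cases) simp_all
qed

lemma card_F_gt_1: "card F > 1"
proof -
  have "card {0, e} \<le> card F"
    by (rule card_mono) (auto simp: finite_F)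
  then show ?thesis
    by (simp split: if_splits)
qed

text \<open>Two linear equations in three unknowns have a nonzero solution. By pigeonhole, as p^3 >
  p^2 for p = \<open>card F\<close>, two triples have the same pair of values; their difference is
  scaled by the inverse of its first nonzero coordinate.\<close>

lemma point_orthogonal:
  assumes "u \<in> rows" "w \<in> rows"
  obtains l where "l \<in> points" "dot u l = 0" "dot w l = 0"
proof -
  let ?f = "\<lambda>m. (dot u m, dot w m)"
  have "card (F \<times> F) < card rows"
    using card_F_gt_1 by (simp add: rows_def card_cartesian_product)
  moreover have "?f ` rows \<subseteq> F \<times> F"
    using dot_F[OF assms(1)] dot_F[OF assms(2)] by blast
  ultimately have "\<not> inj_on ?f rows"
    using card_inj_on_le[of ?f rows "F \<times> F"] finite_F by auto
  then obtain m n where mn: "m \<in> rows" "n \<in> rows" "m \<noteq> n" "?f m = ?f n"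
    unfolding inj_on_def by blast
  define k where "k = m - n"
  have k: "k \<in> rows" "k \<noteq> 0"
    using mn by (simp_all add: k_def rows_diff)
  have orth: "dot u k = 0" "dot w k = 0"
    using mn by (cases u; cases w; cases m; cases n; simp add: k_def algebra_simps)+
  obtain k1 k2 k3 where k_eq: "k = (k1, k2, k3)" and kF: "k1 \<in> F" "k2 \<in> F" "k3 \<in> F"
    using k by (auto simp: rows_def)
  have scaled: "dot u (scale_row c k) = 0" "dot w (scale_row c k) = 0" for c
    using arg_cong[OF orth(1), of "(*) c"] arg_cong[OF orth(2), of "(*) c"]
    by (cases u; cases w; simp add: k_eq algebra_simps)+
  have "\<exists>c. scale_row c k \<in> points"
  proof (cases "k1 = 0")
    case False
    then obtain c where "c \<in> F" "k1 * c = e"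
      using inverse_F kF by blast
    then show ?thesis
      using kF by (intro exI[of _ c]) (auto simp: k_eq points_def mult.commute)
  next
    case k1: True
    show ?thesis
    proof (cases "k2 = 0")
      case False
      then obtain c where "c \<in> F" "k2 * c = e"
        using inverse_F kF by blast
      then show ?thesis
        using kF k1 by (intro exI[of _ c]) (auto simp: k_eq points_def mult.commute)
    next
      case True
      then have "k3 \<noteq> 0"
        using k k1 by (auto simp: k_eq zero_prod_def)
      then obtain c where "c \<in> F" "k3 * c = e"
        using inverse_F kF by blast
      then show ?thesis
        using k1 True by (intro exI[of _ c]) (auto simp: k_eq points_def mult.commute)
    qed
  qed
  then show ?thesis
    using that scaled by blast
qed

lemma card_points: "card points = 1 + card F + (card F)\<^sup>2"
proof -
  let ?P = "(\<lambda>(x, y). (e, x, y)) ` (F \<times> F)" and ?L = "(\<lambda>x. (0 :: 'r, e, x)) ` F"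
  have "card ?P = (card F)\<^sup>2"
    by (subst card_image) (auto simp: inj_on_def power2_eq_square card_cartesian_product)
  moreover have "card ?L = card F"
    by (subst card_image) (auto simp: inj_on_def)
  moreover have "card (?P \<union> ?L) = card ?P + card ?L"
    by (rule card_Un_disjoint) (auto simp: finite_F)
  moreover have "card points = card (?P \<union> ?L) + 1"
    unfolding points_def using finite_F e_nonzero by (subst card_Un_disjoint) auto
  ultimately show ?thesis
    by simp
qed

lemma finite_points: "finite points"
  by (simp add: points_def finite_F)

section \<open>Translations contained in an arbitrary subgroup\<close>

lemma mult_closed_G:
  assumes "subgroup K G" "(A, g) \<in> K" "(B, h) \<in> K"
  shows "(A + act_rows g B, mat2_mult g h) \<in> K"
  using subgroup.m_closed[OF assms] by (simp add: mult_G)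

lemma subgroup_G_mem:
  assumes "subgroup K G" "(A, h) \<in> K"
  shows "A \<in> matrices" "h \<in> Q8"
  using subgroup.mem_carrier[OF assms] by (auto simp: carrier_G)

text \<open>The translation is the quotient of \<open>(A, h)\<close> by \<open>(B, h)\<close>:
  elements over the same \<open>h\<close> differ by a translation in \<open>K\<close>.\<close>

lemma kernel_diff:
  assumes K: "subgroup K G" and Ah: "(A, h) \<in> K" and Bh: "(B, h) \<in> K"
  shows "(A - B, q1) \<in> K"
proof -
  have h: "h \<in> Q8" and B: "B \<in> matrices"
    using subgroup_G_mem[OF K Bh] by blast+
  have "(- act_rows (adjugate h) B, adjugate h) \<in> K"
    using subgroup.m_inv_closed[OF K Bh] h B by (simp add: inv_G)
  from mult_closed_G[OF K Ah this] show ?thesis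
    using h B by (simp add: act_rows_uminus mult_adjugate act_rows_q1 flip: act_rows_mult)
qed

lemma kernel_add:
  assumes K: "subgroup K G" and A: "(A, q1) \<in> K" and B: "(B, h) \<in> K"
  shows "(A + B, h) \<in> K"
  using mult_closed_G[OF K A B] subgroup_G_mem[OF K B] by (simp add: act_rows_q1 mult_q1)

text \<open>Conjugating a translation by an element over \<open>h\<close> applies \<open>h\<close>
  to it. Here the conjugate is obtained as the quotient of \<open>(A, h)\<close> times
  \<open>(B, q1)\<close> by \<open>(A, h)\<close>.\<close>

lemma kernel_act:
  assumes K: "subgroup K G" and A: "(A, h) \<in> K" and B: "(B, q1) \<in> K"
  shows "(act_rows h B, q1) \<in> K"
proof -
  have "(A + act_rows h B, h) \<in> K"
    using mult_closed_G[OF K A B] subgroup_G_mem[OF K A] by (simp add: mult_q1)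
  from kernel_diff[OF K this A] show ?thesis
    by simp
qed

text \<open>In a prime field, scaling is repeated addition, so the translations in \<open>K\<close>
  form not just an additive group but a subspace over \<open>F\<close>.\<close>

lemma kernel_scale:
  assumes K: "subgroup K G" and B: "(B, q1) \<in> K" and c: "c \<in> F"
  shows "(act_rows (c, 0, 0, c) B, q1) \<in> K"
proof -
  obtain n where n: "c = of_nat n * e"
    using prime_F c by blast
  have "B \<in> matrices"
    using subgroup_G_mem[OF K B] by blast
  have "(act_rows (of_nat n * e, 0, 0, of_nat n * e) B, q1) \<in> K"
  proof (induction n)
    case 0
    have "act_rows (0, 0, 0, 0) B = 0"
      by (cases B) (auto simp: zero_prod_def)
    then show ?case
      using subgroup.one_closed[OF K] by (simp add: one_G)
  next
    case (Suc n)
    have "act_rows (of_nat (Suc n) * e, 0, 0, of_nat (Suc n) * e) B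
        = B + act_rows (of_nat n * e, 0, 0, of_nat n * e) B"
      using \<open>B \<in> matrices\<close> by (auto simp: rows_def algebra_simps)
    then show ?case
      using kernel_add[OF K B Suc.IH] by simp
  qed
  then show ?thesis
    by (simp add: n)
qed

lemma half_F: obtains r where "r \<in> F" "\<And>x. x \<in> F \<Longrightarrow> r * (x + x) = x"
proof -
  obtain r where r: "r \<in> F" "(e + e) * r = e"
    using inverse_F[OF add_F[OF e_F e_F]] two_e by blast
  have "r * (x + x) = x" if "x \<in> F" for x
  proof -
    have "r * (x + x) = r * ((e + e) * x)"
      using that by (simp only: distrib_right e_mult)
    also have "\<dots> = ((e + e) * r) * x"
      by (simp only: mult_ac)
    also have "\<dots> = x"
      using that by (simp only: r e_mult)
    finally show ?thesis .
  qed
  then show ?thesis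
    using that r by blast
qed

lemma kernel_half:
  assumes K: "subgroup K G" and B: "(B + B, q1) \<in> K" and "B \<in> matrices"
  shows "(B, q1) \<in> K"
proof -
  obtain r where r: "r \<in> F" "\<And>x. x \<in> F \<Longrightarrow> r * (x + x) = x"
    using half_F by blast
  have "act_rows (r, 0, 0, r) (B + B) = B"
    using r \<open>B \<in> matrices\<close> by (auto simp: rows_def)
  then show ?thesis
    using kernel_scale[OF K B r(1)] by simp
qed

text \<open>The matrices 1, \<open>qj\<close> and \<open>qi\<close> times \<open>qj\<close> already
  combine to a projection: 1 + b i j - a j is twice the matrix unit that keeps the first row and
  kills the second.\<close>

lemma kernel_fst_row:
  assumes K: "subgroup K G" and i: "(A, qi) \<in> K" and j: "(B, qj) \<in> K"
    and uw: "((u, w), q1) \<in> K"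
  shows "((u, 0), q1) \<in> K"
proof -
  let ?X = "(u, w)"
  let ?Y = "act_rows (b, 0, 0, b) (act_rows qi (act_rows qj ?X))"
  let ?Z = "act_rows (a, 0, 0, a) (act_rows qj ?X)"
  have rows: "u \<in> rows" "w \<in> rows"
    using subgroup_G_mem[OF K uw] by auto
  have "(?Y, q1) \<in> K" "(?Z, q1) \<in> K"
    using kernel_act[OF K] kernel_scale[OF K] i j uw a_F b_F by blast+
  then have "(?X + (?Y - ?Z), q1) \<in> K"
    using kernel_add[OF K uw] kernel_diff[OF K] by blast
  also have "?X + (?Y - ?Z) = (u, 0) + (u, 0)"
    using rows by (auto simp: rows_def q_defs zero_prod_def algebra_simps aa abs_aa)
  finally show ?thesis
    using kernel_half[OF K, of "(u, 0)"] rows by simp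
qed

lemma kernel_swap:
  assumes K: "subgroup K G" and i: "(A, qi) \<in> K" and uw: "((u, w), q1) \<in> K"
  shows "((- w, u), q1) \<in> K"
proof -
  have "act_rows qi (u, w) = (- w, u)"
    using subgroup_G_mem[OF K uw] by (auto simp: qi_def rows_def)
  then show ?thesis
    using kernel_act[OF K i uw] by simp
qed

lemma kernel_uminus: "subgroup K G \<Longrightarrow> (A, q1) \<in> K \<Longrightarrow> (- A, q1) \<in> K"
  using kernel_diff[of K 0 q1 A] subgroup.one_closed[of K G] by (simp add: one_G)

lemma kernel_snd_row:
  assumes K: "subgroup K G" and i: "(A, qi) \<in> K" and j: "(B, qj) \<in> K"
    and uw: "((u, w), q1) \<in> K"
  shows "((w, 0), q1) \<in> K"
  using kernel_uminus[OF K kernel_fst_row[OF K i j kernel_swap[OF K i uw]]] by simp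

text \<open>\<open>qi\<close> moves \<open>(w, 0)\<close> to \<open>(0, w)\<close>. Together with
  \<open>kernel_fst_row\<close> and \<open>kernel_snd_row\<close> this shows that, once
  \<open>K\<close> has elements over \<open>qi\<close> and \<open>qj\<close>, its translations are
  all pairs of rows from a single subspace of F^3.\<close>

lemma kernel_pair:
  assumes K: "subgroup K G" and i: "(A, qi) \<in> K"
    and u: "((u, 0), q1) \<in> K" and w: "((w, 0), q1) \<in> K"
  shows "((u, w), q1) \<in> K"
  using kernel_add[OF K u kernel_swap[OF K i w]] by simp

lemma kernel_row_combination:
  assumes K: "subgroup K G" and u: "((u, 0), q1) \<in> K" and w: "((w, 0), q1) \<in> K"
    and "c \<in> F" "d \<in> F"
  shows "((scale_row c u + scale_row d w, 0), q1) \<in> K"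
  using kernel_add[OF K kernel_scale[OF K u \<open>c \<in> F\<close>] kernel_scale[OF K w \<open>d \<in> F\<close>]]
  by (cases u; cases w) (simp add: zero_prod_def)

section \<open>The maximal subgroups and the minimal cover\<close>

lemma M_I: "A \<in> matrices \<Longrightarrow> h \<in> Q8 \<Longrightarrow> mult_col A l = v - act_col h v \<Longrightarrow> (A, h) \<in> M l v"
  by (simp only: M_def mem_Collect_eq case_prod_conv simp_thms)

lemma M_D:
  assumes "(A, h) \<in> M l v"
  shows "A \<in> matrices" "h \<in> Q8" "mult_col A l = v - act_col h v"
  using assms by (simp_all only: M_def mem_Collect_eq case_prod_conv)

lemma kernel_M:
  assumes "(A, q1) \<in> M l v" "v \<in> F \<times> F"
  shows "mult_col A l = 0"
  using M_D(3)[OF assms(1)] act_col_q1[OF assms(2)] by simp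

text \<open>The two relations \<open>i\<^sup>2 = j\<^sup>2 = - 1\<close> turn the chosen pair into kernel elements
  spanning the whole intersection of \<open>M l v\<close> with the translation subgroup.\<close>

lemma M_generating_pair:
  assumes l: "l \<in> points" and v: "v \<in> F \<times> F"
  obtains x y where "x \<in> M l v" "y \<in> M l v"
    "\<And>K. subgroup K G \<Longrightarrow> x \<in> K \<Longrightarrow> y \<in> K \<Longrightarrow> K = M l v \<or> K = carrier G"
proof -
  obtain t w1 w2 where t: "t \<in> rows" "dot t l = e" and w: "w1 \<in> rows" "w2 \<in> rows"
    "dot w1 l = 0" "dot w2 l = 0"
    and span: "\<And>u. u \<in> rows \<Longrightarrow> dot u l = 0 \<Longrightarrow>
      \<exists>c\<in>F. \<exists>d\<in>F. u = scale_row c w1 + scale_row d w2"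
    by (rule point_dual_basis[OF l]) (rule that)
  \<comment> \<open>\<open>S\<close> is chosen with \<open>mult_col S l = v\<close>; conjugation by
    the translation by \<open>S\<close> carries \<open>M l 0\<close> to
    \<open>M l v\<close>.\<close>
  define S where "S = (scale_row (fst v) t, scale_row (snd v) t)"
  define W where "W = (w1, w2)"
  have S: "S \<in> matrices" and W: "W \<in> matrices"
    using v t w by (auto simp: S_def W_def rows_scale)
  have Sl: "mult_col S l = v" and Wl: "mult_col W l = 0"
    using v t w by (simp_all add: S_def W_def dot_scale_row zero_prod_def mem_Times_iff)
  \<comment> \<open>Without \<open>W\<close> the two elements would be the conjugates of
    \<open>qi\<close> and \<open>qj\<close> by the translation by \<open>S\<close> and generate only
    a copy of \<open>Q8\<close>. The summand \<open>W\<close> is annihilated by \<open>l\<close>, so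
    it stays inside \<open>M l v\<close>.\<close>
  define A where "A = S - act_rows qi S + W"
  define B where "B = S - act_rows qj S"
  have AB: "A \<in> matrices" "B \<in> matrices"
    unfolding A_def B_def by (intro matrices_add matrices_diff matrices_act_Q8 S W q_in_Q8)+
  have AM: "(A, qi) \<in> M l v"
    using AB by (intro M_I) (simp_all add: A_def mult_col_add mult_col_diff mult_col_act_rows Sl Wl)
  have BM: "(B, qj) \<in> M l v"
    using AB by (intro M_I) (simp_all add: B_def mult_col_diff mult_col_act_rows Sl)
  have "K = M l v \<or> K = carrier G" if K: "subgroup K G" and AK: "(A, qi) \<in> K" and BK: "(B, qj) \<in> K" for K
  proof -
    have sq: "mat2_mult qi qi = qm" "mat2_mult qj qj = qm"
      by (simp_all add: q_defs aa mult.commute[of b a])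
    have qm: "act_rows qm C = - C" if "C \<in> matrices" for C
      using that by (auto simp: rows_def qm_def zero_prod_def)
    have ii: "act_rows qi (act_rows qi C) = - C" "act_rows qj (act_rows qj C) = - C" if "C \<in> matrices" for C
      using that by (simp_all add: sq qm flip: act_rows_mult)
    \<comment> \<open>Both squares lie over \<open>qm\<close>. Their matrix parts are 2 S + W + i W
      and 2 S, so the quotient no longer contains \<open>S\<close>.\<close>
    have "(A + act_rows qi A, qm) \<in> K" "(B + act_rows qj B, qm) \<in> K"
      using mult_closed_G[OF K AK AK] mult_closed_G[OF K BK BK] by (simp_all add: sq)
    from kernel_diff[OF K this]
    have Z: "(W + act_rows qi W, q1) \<in> K"
      by (simp add: A_def B_def act_rows_add act_rows_diff ii S)
    \<comment> \<open>Here (1 - i) (1 + i) = 1 - i^2 = 2 isolates \<open>W\<close>.\<close>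
    have "(W + act_rows qi W - act_rows qi (W + act_rows qi W), q1) \<in> K"
      using kernel_diff[OF K Z kernel_act[OF K AK Z]] .
    then have "(W + W, q1) \<in> K"
      by (simp add: act_rows_add ii W)
    from kernel_half[OF K this W] have W_K: "((w1, w2), q1) \<in> K"
      by (simp add: W_def)
    note w1 = kernel_fst_row[OF K AK BK W_K] and w2 = kernel_snd_row[OF K AK BK W_K]
    have orth: "((u, 0), q1) \<in> K" if "u \<in> rows" "dot u l = 0" for u
      using span[OF that] kernel_row_combination[OF K w1 w2] by blast
    have ker: "(C, q1) \<in> K" if C: "C \<in> matrices" "mult_col C l = 0" for C
    proof -
      obtain u u' where u: "C = (u, u')" by (cases C)
      then have "u \<in> rows" "dot u l = 0" "u' \<in> rows" "dot u' l = 0"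
        using C by (simp_all add: zero_prod_def)
      then show ?thesis
        unfolding u by (rule kernel_pair[OF K AK orth orth])
    qed
    have KM: "subgroup (K \<inter> M l v) G"
      using group.subgroups_Inter_pair[OF group_G K subgroup_M[OF v]] .
    \<comment> \<open>\<open>P h\<close> says that \<open>K \<inter> M l v\<close> has an element
      over \<open>h\<close>. It holds on all of \<open>Q8\<close> because \<open>qi\<close> and
      \<open>qj\<close> generate it.\<close>
    define P where "P h \<longleftrightarrow> (\<exists>D. (D, h) \<in> K \<inter> M l v)" for h
    have P_mult: "P (mat2_mult g h)" if "P g" "P h" for g h
      using mult_closed_G[OF KM] that unfolding P_def by blast
    have P_gen: "P q1" "P qi" "P qj"
      using subgroup.one_closed[OF KM] AK BK AM BM unfolding P_def one_G by blast+
    have P_qm: "P qm"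
      using P_mult[OF P_gen(2,2)] by (simp only: sq)
    have P_k: "P (mat2_mult qi qj)"
      by (rule P_mult[OF P_gen(2,3)])
    have "P h" if "h \<in> Q8" for h
      using that P_gen P_qm P_k P_gen(2,3)[THEN P_mult[OF P_qm]] P_mult[OF P_qm P_k] unfolding Q8_def
      by (elim insertE emptyE; simp only:)
    then have lift: "\<exists>D. (D, h) \<in> K \<and> (D, h) \<in> M l v" if "h \<in> Q8" for h
      using that unfolding P_def by blast
    have mem: "(C, h) \<in> K" if "(D, h) \<in> K" "(C - D, q1) \<in> K" for C D h
      using kernel_add[OF K that(2,1)] by simp
    have "M l v \<subseteq> K"
    proof
      fix x assume "x \<in> M l v"
      then obtain C h where x: "x = (C, h)" "(C, h) \<in> M l v"
        by (cases x) blast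
      obtain D where D: "(D, h) \<in> K" "(D, h) \<in> M l v"
        using lift M_D(2)[OF x(2)] by blast
      have "mult_col (C - D) l = 0"
        using M_D(3)[OF x(2)] M_D(3)[OF D(2)] by (simp add: mult_col_diff)
      then have "(C - D, q1) \<in> K"
        by (rule ker[OF matrices_diff[OF M_D(1)[OF x(2)] M_D(1)[OF D(2)]]])
      then show "x \<in> K"
        using mem D x by blast
    qed
    \<comment> \<open>Dividing an element of \<open>K\<close> outside \<open>M l v\<close> by one of
      \<open>K \<inter> M l v\<close> over the same \<open>h\<close> gives a translation that does
      not kill \<open>l\<close>. One of its rows lies outside the annihilator of \<open>l\<close>, a
      plane already available in \<open>K\<close>, and together they span F^3.\<close>
    moreover have "K = carrier G" if not_sub: "\<not> K \<subseteq> M l v"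
    proof -
      obtain x where x: "x \<in> K" "x \<notin> M l v"
        using not_sub by blast
      obtain C h where "x = (C, h)" by (cases x)
      then have C: "(C, h) \<in> K" "(C, h) \<notin> M l v"
        using x by blast+
      note Ch = subgroup_G_mem[OF K C(1)]
      obtain D where D: "(D, h) \<in> K" "(D, h) \<in> M l v"
        using lift Ch(2) by blast
      have "mult_col (C - D) l \<noteq> 0"
        using C(2) M_I[OF Ch, of l v] M_D(3)[OF D(2)] by (auto simp: mult_col_diff)
      moreover obtain u u' where uu': "C - D = (u, u')" by (cases "C - D")
      ultimately have "dot u l \<noteq> 0 \<or> dot u' l \<noteq> 0"
        by (auto simp: zero_prod_def)
      moreover have mem_K: "((u, u'), q1) \<in> K"
        using kernel_diff[OF K C(1) D(1)] uu' by simp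
      ultimately obtain z where z: "((z, 0), q1) \<in> K" "dot z l \<noteq> 0"
        using kernel_fst_row[OF K AK BK mem_K] kernel_snd_row[OF K AK BK mem_K] by blast
      have z_rows: "z \<in> rows"
        using subgroup_G_mem[OF K z(1)] by simp
      have l_rows: "l \<in> rows"
        using l points_rows by blast
      then have zl: "dot z l \<in> F"
        using dot_F z_rows by blast
      then obtain r where r: "r \<in> F" "dot z l * r = e"
        using inverse_F z by blast
      have all: "((u, 0), q1) \<in> K" if u: "u \<in> rows" for u
      proof -
        define c where "c = dot u l * r"
        have c: "c \<in> F"
          unfolding c_def by (rule mult_F[OF dot_F[OF u l_rows] r(1)])
        have "c * dot z l = dot u l * (dot z l * r)"
          by (simp only: c_def mult_ac)
        also have "\<dots> = dot u l"
          using dot_F[OF u l_rows] by (simp add: r)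
        finally have "dot (u - scale_row c z) l = 0"
          by (simp add: dot_diff dot_scale_row)
        then have "((u - scale_row c z, 0), q1) \<in> K"
          by (rule orth[OF rows_diff[OF u rows_scale[OF c z_rows]]])
        from kernel_row_combination[OF K this z(1) e_F c] show ?thesis
          using rows_diff[OF u rows_scale[OF c z_rows]] by (simp add: scale_row_e)
      qed
      have "carrier G \<subseteq> K"
      proof
        fix x assume "x \<in> carrier G"
        then obtain C h where x: "x = (C, h)" "C \<in> matrices" "h \<in> Q8"
          by (auto simp: carrier_G)
        obtain D where D: "(D, h) \<in> K"
          using lift x by blast
        have "C - D \<in> matrices"
          by (rule matrices_diff[OF x(2) subgroup_G_mem(1)[OF K D]])
        moreover obtain u u' where uu': "C - D = (u, u')" by (cases "C - D")
        ultimately have "u \<in> rows" "u' \<in> rows"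
          by simp_all
        then have "(C - D, q1) \<in> K"
          unfolding uu' by (rule kernel_pair[OF K AK all all])
        then show "x \<in> K"
          using mem D x by blast
      qed
      then show ?thesis
        using subgroup.subset[OF K] by blast
    qed
    ultimately show ?thesis
      by blast
  qed
  then show ?thesis
    using that AM BM by blast
qed

lemma M_proper:
  assumes l: "l \<in> points" and v: "v \<in> F \<times> F"
  shows "M l v \<noteq> carrier G"
proof
  assume eq: "M l v = carrier G"
  obtain t where t: "t \<in> rows" "dot t l = e"
    by (rule point_dual_basis[OF l]) (rule that)
  then have "((t, 0), q1) \<in> M l v"
    by (simp add: eq carrier_G)
  from kernel_M[OF this v] show False
    using t by (simp add: zero_prod_def)
qed

text \<open>The translations in \<open>M l v\<close> determine the annihilator of \<open>l\<close>,
  hence \<open>l\<close>. The elements over \<open>qi\<close> then determine v - i v, and 1 - i is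
  injective because 2 is invertible.\<close>

lemma M_inj: "inj_on (\<lambda>(l, v). M l v) (points \<times> (F \<times> F))"
proof (rule inj_onI)
  fix s s' assume s: "s \<in> points \<times> (F \<times> F)" "s' \<in> points \<times> (F \<times> F)"
    and s_eq: "(\<lambda>(l, v). M l v) s = (\<lambda>(l, v). M l v) s'"
  obtain l v where "s = (l, v)" by (cases s)
  moreover obtain l' v' where "s' = (l', v')" by (cases s')
  ultimately have lv: "s = (l, v)" "s' = (l', v')"
    by blast+
  have l: "l \<in> points" "l' \<in> points" and v: "v \<in> F \<times> F" "v' \<in> F \<times> F"
    using s unfolding lv by blast+
  have eq: "M l v = M l' v'"
    using s_eq by (simp add: lv)
  have "dot u l' = 0" if "u \<in> rows" "dot u l = 0" for u
  proof -
    have "mult_col (u, 0) l = 0"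
      using that(2) by (cases l) (simp add: zero_prod_def)
    then have "((u, 0), q1) \<in> M l v"
      using that(1) act_col_q1[OF v(1)] by (intro M_I) simp_all
    from kernel_M[OF this[unfolded eq] v(2)] show ?thesis
      by (simp add: zero_prod_def)
  qed
  then have l_eq: "l = l'"
    using point_eqI l by blast
  obtain x y where v_eq: "v = (x, y)" "x \<in> F" "y \<in> F"
    using v by blast
  obtain x' y' where v'_eq: "v' = (x', y')" "x' \<in> F" "y' \<in> F"
    using v by blast
  obtain t where t: "t \<in> rows" "dot t l = e"
    by (rule point_dual_basis[OF l(1)]) (rule that)
  define S where "S = (scale_row x t, scale_row y t)"
  have S: "S \<in> matrices" "mult_col S l = v"
    using t v_eq by (simp_all add: S_def rows_scale dot_scale_row)
  have "(S - act_rows qi S, qi) \<in> M l v"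
    using S by (intro M_I matrices_diff matrices_act_Q8) (simp_all add: mult_col_diff mult_col_act_rows)
  from M_D(3)[OF this[unfolded eq]] have "mult_col (S - act_rows qi S) l = v' - act_col qi v'"
    by (simp only: l_eq)
  then have "v - act_col qi v = v' - act_col qi v'"
    by (simp add: mult_col_diff mult_col_act_rows S)
  then have sums: "x + y = x' + y'" "y - x = y' - x'"
    using v_eq v'_eq by (simp_all add: qi_def)
  have "(x - x') + (x - x') = (x + y) - (y - x) - ((x' + y') - (y' - x'))"
    by simp
  then have "(x - x') + (x - x') = 0"
    using sums by simp
  then have "x = x'"
    using double_F[of "x - x'"] v_eq v'_eq by simp
  then show "s = s'"
    using sums l_eq v_eq v'_eq lv by simp
qed

text \<open>The rows of the two matrices include the standard basis of F^3, which no point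
  annihilates.\<close>

lemma translation_pair_not_in_M:
  assumes "l \<in> points" "v \<in> F \<times> F"
  shows "\<not> ((((e, 0, 0), (0, e, 0)), q1) \<in> M l v \<and> (((0, 0, e), 0), q1) \<in> M l v)"
proof
  assume "(((e, 0, 0), (0, e, 0)), q1) \<in> M l v \<and> (((0, 0, e), 0), q1) \<in> M l v"
  then have "mult_col ((e, 0, 0), (0, e, 0)) l = 0" "mult_col ((0, 0, e), 0) l = 0"
    using kernel_M assms(2) by blast+
  with assms(1) show False
    by (cases rule: points_cases) (simp_all add: zero_prod_def)
qed

text \<open>The matrix \<open>m\<close> is the adjugate of 1 - h divided by its determinant
  \<open>D\<close>. As h has determinant \<open>e\<close>, \<open>D\<close> is 2 minus the trace,
  that is 2 or 4, and nonzero in odd characteristic.\<close>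

lemma inverse_one_minus:
  assumes "h \<in> Q8" "h \<noteq> q1"
  obtains m where "m \<in> F \<times> F \<times> F \<times> F"
    "\<And>c. c \<in> F \<times> F \<Longrightarrow> act_col m c - act_col h (act_col m c) = c"
proof -
  obtain x y z w where h: "h = (x, y, z, w)" by (cases h)
  have F: "x \<in> F" "y \<in> F" "z \<in> F" "w \<in> F"
    using Q8_F[OF assms(1)[unfolded h]] by simp_all
  have det: "x * w - y * z = e"
    by (rule Q8_det[OF assms(1)[unfolded h]])
  define D where "D = (e - x) * (e - w) - y * z"
  have DF: "D \<in> F"
    using F by (simp add: D_def)
  have "D = e + e - (x + w)"
  proof -
    have "D = e - (x + w) + (x * w - y * z)"
      using F by (simp add: D_def left_diff_distrib right_diff_distrib)
    then show ?thesis
      by (simp add: det)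
  qed
  moreover have "x + w = 0 \<or> x + w = - e - e"
    by (rule Q8_trace[OF assms[unfolded h]])
  ultimately have "D = e + e \<or> D = (e + e) + (e + e)"
    by (elim disjE) simp_all
  then have "D \<noteq> 0"
    using two_e double_F[OF add_F[OF e_F e_F]] by metis
  then obtain r where r: "r \<in> F" "D * r = e"
    using inverse_F[of D] DF by blast
  define m where "m = (r * (e - w), r * y, r * z, r * (e - x))"
  have "m \<in> F \<times> F \<times> F \<times> F"
    using F r by (simp add: m_def)
  moreover have "act_col m c - act_col h (act_col m c) = c" if c: "c \<in> F \<times> F" for c
  proof -
    obtain c1 c2 where c12: "c = (c1, c2)" "c1 \<in> F" "c2 \<in> F"
      using c by blast
    let ?d1 = "(e - w) * c1 + y * c2" and ?d2 = "z * c1 + (e - x) * c2"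
    have mc: "act_col m c = (r * ?d1, r * ?d2)"
      by (simp add: m_def c12 distrib_left mult.assoc)
    have rd: "r * ?d1 \<in> F" "r * ?d2 \<in> F"
      using F c12 r by simp_all
    have 1: "r * ?d1 - (x * (r * ?d1) + y * (r * ?d2)) = c1"
    proof -
      \<comment> \<open>With the explicit factor \<open>e\<close> this is a polynomial identity;
        \<open>e_mult\<close> and \<open>mult_e\<close> are switched off so that \<open>e\<close> is
        treated as an indeterminate.\<close>
      have "e * (r * ?d1) - (x * (r * ?d1) + y * (r * ?d2)) = (D * r) * c1"
        by (simp add: D_def algebra_simps del: e_mult mult_e)
      then show ?thesis
        by (simp only: e_mult rd r c12)
    qed
    have 2: "r * ?d2 - (z * (r * ?d1) + w * (r * ?d2)) = c2"
    proof -
      have "e * (r * ?d2) - (z * (r * ?d1) + w * (r * ?d2)) = (D * r) * c2"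
        by (simp add: D_def algebra_simps del: e_mult mult_e)
      then show ?thesis
        by (simp only: e_mult rd r c12)
    qed
    show ?thesis
      unfolding mc by (simp only: h act_col.simps diff_Pair 1 2 c12(1))
  qed
  ultimately show ?thesis
    using that by blast
qed

lemma M_cover:
  assumes h: "h \<in> Q8" "h \<noteq> q1" and k: "k \<in> Q8" and AB: "A \<in> matrices" "B \<in> matrices"
  obtains l v where "l \<in> points" "v \<in> F \<times> F" "(A, h) \<in> M l v" "(B, k) \<in> M l v"
proof -
  obtain m where m: "m \<in> F \<times> F \<times> F \<times> F"
    "\<And>c. c \<in> F \<times> F \<Longrightarrow> act_col m c - act_col h (act_col m c) = c"
    using inverse_one_minus[OF h] by blast
  \<comment> \<open>With S = (1 - h)^-1 A, the choice v = S l meets the condition for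
    \<open>(A, h)\<close> whatever \<open>l\<close> is. The condition for \<open>(B, k)\<close>
    becomes (B - (1 - k) S) l = 0, two linear equations for \<open>l\<close>.\<close>
  define S where "S = act_rows m A"
  have S: "S \<in> matrices"
    unfolding S_def by (rule matrices_act[OF m(1) AB(1)])
  have "B - (S - act_rows k S) \<in> matrices"
    by (intro matrices_diff matrices_act_Q8 AB S k)
  then obtain u w where uw: "B - (S - act_rows k S) = (u, w)" "u \<in> rows" "w \<in> rows"
    by blast
  obtain l where l: "l \<in> points" "dot u l = 0" "dot w l = 0"
    using point_orthogonal uw by blast
  have l_rows: "l \<in> rows"
    using l points_rows by blast
  define v where "v = mult_col S l"
  have mult_col_F: "mult_col C l \<in> F \<times> F" if "C \<in> matrices" for C
    using that dot_F[OF _ l_rows] by (cases C) simp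
  have v: "v \<in> F \<times> F"
    unfolding v_def by (rule mult_col_F[OF S])
  have "mult_col A l = v - act_col h v"
    using m(2)[OF mult_col_F[OF AB(1)]] by (simp add: v_def S_def mult_col_act_rows)
  then have "(A, h) \<in> M l v"
    by (rule M_I[OF AB(1) h(1)])
  moreover have "mult_col (B - (S - act_rows k S)) l = 0"
    by (simp add: uw l zero_prod_def)
  then have "mult_col B l = v - act_col k v"
    by (simp add: mult_col_diff mult_col_act_rows v_def)
  then have "(B, k) \<in> M l v"
    by (rule M_I[OF AB(2) k])
  ultimately show ?thesis
    using that l v by blast
qed

section \<open>The covering and the lower bound\<close>

definition translation_group :: "(('r row \<times> 'r row) \<times> 'r mat2) set" where
  "translation_group = matrices \<times> {q1}"

lemma q1_neq_qi: "q1 \<noteq> qi"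
  by (simp add: q1_def qi_def)

lemma subgroup_translation_group: "subgroup translation_group G"
proof (rule group.subgroupI[OF group_G])
  show "translation_group \<subseteq> carrier G"
    unfolding translation_group_def carrier_G using q_in_Q8 by blast
  show "translation_group \<noteq> {}"
    unfolding translation_group_def using zero_matrices by blast
next
  fix x assume "x \<in> translation_group"
  then obtain A where A: "x = (A, q1)" "A \<in> matrices"
    unfolding translation_group_def by blast
  have "adjugate q1 = q1"
    by (simp add: q1_def)
  then show "inv\<^bsub>G\<^esub> x \<in> translation_group"
    unfolding A(1) inv_G[OF A(2) q_in_Q8(1)] translation_group_def
    using A matrices_uminus by (simp add: act_rows_q1 del: mem_Times_iff)
next
  fix x y assume "x \<in> translation_group" "y \<in> translation_group"
  then obtain A B where AB: "x = (A, q1)" "A \<in> matrices" "y = (B, q1)" "B \<in> matrices"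
    unfolding translation_group_def by blast
  show "x \<otimes>\<^bsub>G\<^esub> y \<in> translation_group"
    unfolding AB(1,3) mult_G act_rows_q1[OF AB(4)] mult_q1(1)[OF q_in_Q8(1)] translation_group_def
    using matrices_add[OF AB(2,4)] by blast
qed

lemma translation_group_proper: "translation_group \<noteq> carrier G"
proof
  assume "translation_group = carrier G"
  then have "(0, qi) \<in> translation_group"
    by (simp add: carrier_G)
  then show False
    using q1_neq_qi by (auto simp: translation_group_def)
qed

text \<open>Each of these subgroups maps onto \<open>Q8\<close>, so its product with
  \<open>translation_group\<close> is all of \<open>G\<close>.\<close>

definition supplements :: "(('r row \<times> 'r row) \<times> 'r mat2) set set" where
  "supplements = {M l v | l v. l \<in> points \<and> v \<in> F \<times> F}"

lemma supplements_image: "supplements = (\<lambda>(l, v). M l v) ` (points \<times> (F \<times> F))"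
proof (intro subset_antisym subsetI)
  fix H assume "H \<in> supplements"
  then obtain l v where "l \<in> points" "v \<in> F \<times> F" "H = M l v"
    unfolding supplements_def by blast
  then show "H \<in> (\<lambda>(l, v). M l v) ` (points \<times> (F \<times> F))"
    by (intro image_eqI[of _ _ "(l, v)"] SigmaI) simp_all
next
  fix H assume "H \<in> (\<lambda>(l, v). M l v) ` (points \<times> (F \<times> F))"
  then obtain s where s: "H = (\<lambda>(l, v). M l v) s" "s \<in> points \<times> (F \<times> F)"
    by (rule imageE)
  obtain l v where lv: "s = (l, v)" by (cases s)
  have "l \<in> points" "v \<in> F \<times> F"
    using s(2) unfolding lv by blast+
  moreover have "H = M l v"
    using s(1) lv by simp
  ultimately show "H \<in> supplements"
    unfolding supplements_def by blast
qed

lemma card_supplements: "card supplements = (card F)\<^sup>2 + card F ^ 3 + card F ^ 4"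
  unfolding supplements_image card_image[OF M_inj]
  by (simp add: card_cartesian_product card_points algebra_simps power2_eq_square power3_eq_cube power4_eq_xxxx)

lemma finite_supplements: "finite supplements"
  unfolding supplements_image by (intro finite_imageI finite_cartesian_product finite_points finite_F)

definition minimal_cover :: "(('r row \<times> 'r row) \<times> 'r mat2) set set" where
  "minimal_cover = insert translation_group supplements"

lemma two_covering_minimal_cover: "two_covering G minimal_cover"
  unfolding two_covering_def
proof (intro conjI ballI)
  fix H assume "H \<in> minimal_cover"
  then consider "H = translation_group" | l v where "H = M l v" "l \<in> points" "v \<in> F \<times> F"
    unfolding minimal_cover_def supplements_def by blast
  then show "subgroup H G" "H \<noteq> carrier G"
    using subgroup_translation_group translation_group_proper subgroup_M M_proper by (cases; simp)+
next
  fix x y assume "x \<in> carrier G" "y \<in> carrier G"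
  then obtain A h B k where x: "x = (A, h)" "A \<in> matrices" "h \<in> Q8"
    and y: "y = (B, k)" "B \<in> matrices" "k \<in> Q8"
    unfolding carrier_G by blast
  have M: "M l v \<in> minimal_cover" if "l \<in> points" "v \<in> F \<times> F" for l v
    using that unfolding minimal_cover_def supplements_def by blast
  show "\<exists>H\<in>minimal_cover. x \<in> H \<and> y \<in> H"
  proof (cases "h = q1")
    case False
    then show ?thesis
      using M_cover[OF x(3) _ y(3) x(2) y(2)] M x(1) y(1) by metis
  next
    case h: True
    show ?thesis
    proof (cases "k = q1")
      case False
      then show ?thesis
        using M_cover[OF y(3) _ x(3) y(2) x(2)] M x y by metis
    next
      case True
      then have "x \<in> translation_group" "y \<in> translation_group"
        using x y h unfolding translation_group_def by blast+
      then show ?thesis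
        unfolding minimal_cover_def by blast
    qed
  qed
qed

lemma minimal_cover_le:
  assumes C: "two_covering G C" "finite C"
  shows "1 + (card F)\<^sup>2 + card F ^ 3 + card F ^ 4 \<le> card C"
proof -
  have cover: "\<exists>H\<in>C. subgroup H G \<and> H \<noteq> carrier G \<and> x \<in> H \<and> y \<in> H"
    if "x \<in> carrier G" "y \<in> carrier G" for x y
    using C(1) that unfolding two_covering_def by blast
  have "M l v \<in> C" if lv: "l \<in> points" "v \<in> F \<times> F" for l v
  proof -
    \<comment> \<open>A member of \<open>C\<close> containing this generating pair is
      \<open>M l v\<close> or the whole group, and members are proper.\<close>
    obtain x y where xy: "x \<in> M l v" "y \<in> M l v"
      "\<And>K. subgroup K G \<Longrightarrow> x \<in> K \<Longrightarrow> y \<in> K \<Longrightarrow> K = M l v \<or> K = carrier G"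
      using M_generating_pair[OF lv] by metis
    then show ?thesis
      using cover[of x y] subgroup.mem_carrier[OF subgroup_M[OF lv(2)]] by blast
  qed
  then have "supplements \<subseteq> C"
    unfolding supplements_def by blast
  \<comment> \<open>This pair of translations accounts for the summand 1: the member covering it is
    none of the \<open>M l v\<close>.\<close>
  obtain H where H: "H \<in> C" "(((e, 0, 0), (0, e, 0)), q1) \<in> H" "(((0, 0, e), 0), q1) \<in> H"
    using cover[of "(((e, 0, 0), (0, e, 0)), q1)" "(((0, 0, e), 0), q1)"]
    by (auto simp: carrier_G rows_def zero_prod_def)
  have "H \<notin> supplements"
    using translation_pair_not_in_M H unfolding supplements_def by blast
  then have "card (insert H supplements) = 1 + (card F)\<^sup>2 + card F ^ 3 + card F ^ 4"
    using finite_supplements by (simp add: card_supplements)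
  moreover have "card (insert H supplements) \<le> card C"
    using H \<open>supplements \<subseteq> C\<close> C(2) by (intro card_mono) auto
  ultimately show ?thesis
    by simp
qed

lemma card_minimal_cover: "card minimal_cover = 1 + (card F)\<^sup>2 + card F ^ 3 + card F ^ 4"
proof -
  have "translation_group \<noteq> M l v" if "l \<in> points" "v \<in> F \<times> F" for l v
  proof -
    have "(((e, 0, 0), (0, e, 0)), q1) \<in> translation_group" "(((0, 0, e), 0), q1) \<in> translation_group"
      by (simp_all add: translation_group_def rows_def zero_prod_def)
    then show ?thesis
      using translation_pair_not_in_M[OF that] by blast
  qed
  then have "translation_group \<notin> supplements"
    unfolding supplements_def by blast
  then show ?thesis
    unfolding minimal_cover_def using finite_supplements by (simp add: card_supplements)
qed

lemma finite_minimal_cover: "finite minimal_cover"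
  unfolding minimal_cover_def using finite_supplements by simp

section \<open>Solvability\<close>

text \<open>Commutators of \<open>Q8\<close> are \<open>q1\<close> or \<open>qm\<close>; this gives
  the first step of the derived series.\<close>

lemma Q8_comm: "g \<in> Q8 \<Longrightarrow> h \<in> Q8 \<Longrightarrow>
    mat2_mult g h = mat2_mult h g \<or> mat2_mult g h = mat2_mult qm (mat2_mult h g)"
  unfolding Q8_eq qm_def by (elim insertE emptyE; simp add: aa mult.commute[of b a])

lemma snd_mult_G: "snd (x \<otimes>\<^bsub>G\<^esub> y) = mat2_mult (snd x) (snd y)"
  by (simp add: G_def)

lemma snd_inv_G: "x \<in> carrier G \<Longrightarrow> snd (inv\<^bsub>G\<^esub> x) = adjugate (snd x)"
  by (cases x) (simp add: carrier_G inv_G)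

lemma snd_commutator:
  assumes "x \<in> carrier G" "y \<in> carrier G"
  shows "snd (x \<otimes>\<^bsub>G\<^esub> y \<otimes>\<^bsub>G\<^esub> inv\<^bsub>G\<^esub> x \<otimes>\<^bsub>G\<^esub> inv\<^bsub>G\<^esub> y) \<in> {q1, qm}"
    and "snd x \<in> {q1, qm} \<Longrightarrow> snd y \<in> {q1, qm} \<Longrightarrow>
      snd (x \<otimes>\<^bsub>G\<^esub> y \<otimes>\<^bsub>G\<^esub> inv\<^bsub>G\<^esub> x \<otimes>\<^bsub>G\<^esub> inv\<^bsub>G\<^esub> y) = q1"
proof -
  obtain A h B k where xy: "x = (A, h)" "y = (B, k)" "h \<in> Q8" "k \<in> Q8"
    using assms unfolding carrier_G by blast
  let ?c = "snd (x \<otimes>\<^bsub>G\<^esub> y \<otimes>\<^bsub>G\<^esub> inv\<^bsub>G\<^esub> x \<otimes>\<^bsub>G\<^esub> inv\<^bsub>G\<^esub> y)"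
  have c: "?c = mat2_mult (mat2_mult (mat2_mult h k) (adjugate h)) (adjugate k)"
    using assms by (simp add: snd_mult_G snd_inv_G xy)
  have cancel: "mat2_mult (mat2_mult (mat2_mult k h) (adjugate h)) (adjugate k) = q1"
    using xy by (simp add: mat2_mult_assoc mult_adjugate mult_q1)
  have comm: "?c = q1" if "mat2_mult h k = mat2_mult k h"
    by (simp only: c that cancel)
  have "?c = qm" if "mat2_mult h k = mat2_mult qm (mat2_mult k h)"
    using cancel by (simp only: c that) (simp add: mat2_mult_assoc mult_q1)
  then show "?c \<in> {q1, qm}"
    using Q8_comm[OF xy(3,4)] comm by blast
  assume "snd x \<in> {q1, qm}" "snd y \<in> {q1, qm}"
  then have "mat2_mult h k = mat2_mult k h"
    using xy mult_q1[of qm] by auto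
  then show "?c = q1"
    by (rule comm)
qed

lemma subgroup_signed_translations: "subgroup (matrices \<times> {q1, qm}) G"
proof (rule group.subgroupI[OF group_G])
  show sub: "matrices \<times> {q1, qm} \<subseteq> carrier G"
    unfolding carrier_G using q_in_Q8 by blast
  show "matrices \<times> {q1, qm} \<noteq> {}"
    using zero_matrices by blast
  have mem: "x \<in> matrices \<times> {q1, qm}" if "x \<in> carrier G" "snd x \<in> {q1, qm}" for x
    using that unfolding carrier_G by (simp add: mem_Times_iff)
  fix x y assume x: "x \<in> matrices \<times> {q1, qm}" and y: "y \<in> matrices \<times> {q1, qm}"
  have carr: "x \<in> carrier G" "y \<in> carrier G"
    using sub x y by blast+
  have q: "snd x \<in> {q1, qm}" "snd y \<in> {q1, qm}"
    using x y by (simp_all only: mem_Times_iff)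
  have sq: "mat2_mult qm qm = q1" "adjugate q1 = q1" "adjugate qm = qm"
    by (simp_all add: q_defs)
  show "x \<otimes>\<^bsub>G\<^esub> y \<in> matrices \<times> {q1, qm}"
  proof (rule mem)
    show "x \<otimes>\<^bsub>G\<^esub> y \<in> carrier G"
      by (rule monoid.m_closed[OF group.is_monoid[OF group_G] carr])
    show "snd (x \<otimes>\<^bsub>G\<^esub> y) \<in> {q1, qm}"
      using q mult_q1[of q1] mult_q1[of qm] sq unfolding snd_mult_G by fastforce
  qed
  show "inv\<^bsub>G\<^esub> x \<in> matrices \<times> {q1, qm}"
  proof (rule mem)
    show "inv\<^bsub>G\<^esub> x \<in> carrier G"
      by (rule group.inv_closed[OF group_G carr(1)])
    show "snd (inv\<^bsub>G\<^esub> x) \<in> {q1, qm}"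
      using q sq unfolding snd_inv_G[OF carr(1)] by fastforce
  qed
qed

text \<open>The derived series descends through the matrices paired with \<open>q1\<close> or
  \<open>qm\<close>, then the translations, which commute, and reaches the trivial group after three
  steps.\<close>

lemma solvable_G: "solvable G"
proof -
  interpret group G by (rule group_G)
  let ?P = "matrices \<times> {q1, qm}"
  have P: "?P \<subseteq> carrier G" and T: "translation_group \<subseteq> carrier G"
    using subgroup.subset[OF subgroup_signed_translations] subgroup.subset[OF subgroup_translation_group]
    by blast+
  have incl: "derived G K \<subseteq> L"
    if "subgroup L G" "\<And>x y. x \<in> K \<Longrightarrow> y \<in> K \<Longrightarrow> x \<otimes>\<^bsub>G\<^esub> y \<otimes>\<^bsub>G\<^esub> inv\<^bsub>G\<^esub> x \<otimes>\<^bsub>G\<^esub> inv\<^bsub>G\<^esub> y \<in> L" for K L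
    unfolding derived_def using that by (intro generate_subgroup_incl UN_least) auto
  have closed: "x \<otimes>\<^bsub>G\<^esub> y \<otimes>\<^bsub>G\<^esub> inv\<^bsub>G\<^esub> x \<otimes>\<^bsub>G\<^esub> inv\<^bsub>G\<^esub> y \<in> carrier G"
    if "x \<in> carrier G" "y \<in> carrier G" for x y
    using that by simp
  have carrier_snd: "x \<in> matrices \<times> S" if "x \<in> carrier G" "snd x \<in> S" for x S
    using that unfolding carrier_G by (simp add: mem_Times_iff)
  have 1: "derived G (carrier G) \<subseteq> ?P"
    by (rule incl[OF subgroup_signed_translations carrier_snd[OF closed snd_commutator(1)]])
  have 2: "derived G ?P \<subseteq> translation_group"
  proof (rule incl[OF subgroup_translation_group])
    fix x y assume xy: "x \<in> ?P" "y \<in> ?P"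
    then have "x \<in> carrier G" "y \<in> carrier G" "snd x \<in> {q1, qm}" "snd y \<in> {q1, qm}"
      using P by (blast, blast, simp_all only: mem_Times_iff)
    then show "x \<otimes>\<^bsub>G\<^esub> y \<otimes>\<^bsub>G\<^esub> inv\<^bsub>G\<^esub> x \<otimes>\<^bsub>G\<^esub> inv\<^bsub>G\<^esub> y \<in> translation_group"
      unfolding translation_group_def using snd_commutator(2)
      by (intro carrier_snd closed) simp_all
  qed
  have 3: "derived G translation_group \<subseteq> {\<one>\<^bsub>G\<^esub>}"
  proof (rule incl[OF triv_subgroup])
    fix x y assume xy: "x \<in> translation_group" "y \<in> translation_group"
    then have carr: "x \<in> carrier G" "y \<in> carrier G"
      using T by blast+
    have "x \<otimes>\<^bsub>G\<^esub> y = y \<otimes>\<^bsub>G\<^esub> x"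
    proof -
      obtain A B where "x = (A, q1)" "y = (B, q1)" "A \<in> matrices" "B \<in> matrices"
        using xy unfolding translation_group_def by blast
      then show ?thesis
        by (simp only: mult_G act_rows_q1 add.commute[of A B])
    qed
    then show "x \<otimes>\<^bsub>G\<^esub> y \<otimes>\<^bsub>G\<^esub> inv\<^bsub>G\<^esub> x \<otimes>\<^bsub>G\<^esub> inv\<^bsub>G\<^esub> y \<in> {\<one>\<^bsub>G\<^esub>}"
      using carr by (simp add: m_assoc)
  qed
  have "derived G (derived G (derived G (carrier G))) \<subseteq> {\<one>\<^bsub>G\<^esub>}"
    using mono_derived[OF mono_derived[OF 1]] mono_derived[OF 2] 3 by (meson subset_trans)
  moreover have "\<one>\<^bsub>G\<^esub> \<in> derived G (derived G (derived G (carrier G)))"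
    by (intro subgroup.one_closed derived_is_subgroup derived_in_carrier subset_refl)
  ultimately have "(derived G ^^ 3) (carrier G) = {\<one>\<^bsub>G\<^esub>}"
    by (auto simp: numeral_3_eq_3)
  then show ?thesis
    using solvable_iff_trivial_derived_seq by blast
qed

end

section \<open>The ring of residue families\<close>

text \<open>The product of all rings \<open>\<int> / n\<close>: Isabelle types cannot depend on \<open>p\<close>, but every prime field
  is an ideal of this one ring. Component 0 is \<open>\<int>\<close>, since \<open>x mod 0 = x\<close>.\<close>

typedef residue_family = "{f :: nat \<Rightarrow> int. \<forall>n. f n mod int n = f n}"
  by (intro exI[of _ "\<lambda>_. 0"]) simp

setup_lifting type_definition_residue_family

instantiation residue_family :: comm_ring_1
begin

lift_definition zero_residue_family :: residue_family is "\<lambda>_. 0"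
  by simp

lift_definition one_residue_family :: residue_family is "\<lambda>n. 1 mod int n"
  by simp

lift_definition plus_residue_family :: "residue_family \<Rightarrow> residue_family \<Rightarrow> residue_family"
  is "\<lambda>f g n. (f n + g n) mod int n"
  by simp

lift_definition minus_residue_family :: "residue_family \<Rightarrow> residue_family \<Rightarrow> residue_family"
  is "\<lambda>f g n. (f n - g n) mod int n"
  by simp

lift_definition uminus_residue_family :: "residue_family \<Rightarrow> residue_family"
  is "\<lambda>f n. - f n mod int n"
  by simp

lift_definition times_residue_family :: "residue_family \<Rightarrow> residue_family \<Rightarrow> residue_family"
  is "\<lambda>f g n. (f n * g n) mod int n"
  by simp

instance
proof
  fix x y z :: residue_family
  show "x * y * z = x * (y * z)"
    by transfer (simp add: mod_simps mult.assoc)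
  show "x * y = y * x"
    by transfer (simp add: mult.commute)
  show "1 * x = x"
    by transfer (simp add: mod_simps)
  show "x + y + z = x + (y + z)"
    by transfer (simp add: mod_simps add.assoc)
  show "x + y = y + x"
    by transfer (simp add: add.commute)
  show "0 + x = x"
    by transfer simp
  show "- x + x = 0"
    by transfer (simp add: mod_simps)
  show "x - y = x + - y"
    by transfer (simp add: mod_simps)
  show "(x + y) * z = x * z + y * z"
    by transfer (simp add: mod_simps distrib_right)
  \<comment> \<open>Component 0 is the witness, being the ring of integers; in component 1
    everything is 0.\<close>
  show "(0 :: residue_family) \<noteq> 1"
    by transfer (auto simp: fun_eq_iff intro!: exI[of _ 0])
qed

end

text \<open>The embedding of the integers modulo p as component p, with 0 elsewhere. Thus
  \<open>residue p 1\<close> is an idempotent and serves as the unit \<open>e\<close> of the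
  field.\<close>

lift_definition residue :: "nat \<Rightarrow> int \<Rightarrow> residue_family"
  is "\<lambda>p c n. if n = p then c mod int p else 0"
  by auto

lemma residue_0: "residue p 0 = 0"
  by transfer auto

lemma residue_add: "residue p c + residue p d = residue p (c + d)"
  by transfer (auto simp: mod_simps)

lemma residue_uminus: "- residue p c = residue p (- c)"
  by transfer (auto simp: mod_simps)

lemma residue_mult: "residue p c * residue p d = residue p (c * d)"
  by transfer (auto simp: mod_simps)

lemma residue_eq_iff: "residue p c = residue p d \<longleftrightarrow> c mod int p = d mod int p"
  by transfer (auto simp: fun_eq_iff)

lemma residue_of_nat: "residue p (int n) = of_nat n * residue p 1"
  by (induction n) (simp_all add: residue_0 distrib_right flip: residue_add)

lemma range_residue: "p > 0 \<Longrightarrow> range (residue p) = residue p ` {0..<int p}"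
proof (intro subset_antisym subsetI)
  fix x assume "x \<in> range (residue p)" "p > 0"
  then obtain c where "x = residue p c" by blast
  then have "x = residue p (c mod int p)"
    by (simp add: residue_eq_iff)
  then show "x \<in> residue p ` {0..<int p}"
    using \<open>p > 0\<close> by (intro image_eqI) auto
qed auto

lemma card_range_residue:
  assumes "p > 0"
  shows "card (range (residue p)) = p"
proof -
  have "inj_on (residue p) {0..<int p}"
    by (auto simp: inj_on_def residue_eq_iff)
  then show ?thesis
    using assms by (simp add: range_residue card_image)
qed

text \<open>Pigeonhole: for x and y from 0 to m = (p - 1) / 2 the values x^2 and the values -1 - y^2
  are each m + 1 distinct residues, in total p + 1, so some value is common.\<close>

lemma minus_one_sum_of_two_squares_mod:
  assumes p: "Factorial_Ring.prime p" and "odd p"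
  obtains a b :: int where "(a * a + b * b) mod int p = - 1 mod int p"
proof -
  obtain m where m: "p = 2 * m + 1"
    using \<open>odd p\<close> by (elim oddE)
  have p_int: "Factorial_Ring.prime (int p)"
    using p by (simp only: prime_nat_int_transfer)
  let ?I = "{0..int m}"
  let ?f = "\<lambda>x. x * x mod int p" and ?g = "\<lambda>y. (- 1 - y * y) mod int p"
  \<comment> \<open>The bound m keeps both x - y and x + y below p in absolute value, so p divides
    one of them only if it is 0; a zero sum forces both to vanish.\<close>
  have eq: "x = y" if xy: "x \<in> ?I" "y \<in> ?I" and dvd: "int p dvd x * x - y * y" for x y
  proof -
    have "x * x - y * y = (x - y) * (x + y)"
      by (simp add: algebra_simps)
    then have "int p dvd x - y \<or> int p dvd x + y"
      using dvd prime_dvd_mult_iff[OF p_int] by metis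
    moreover have "\<bar>x - y\<bar> < int p" "\<bar>x + y\<bar> < int p"
      using xy by (auto simp: m abs_less_iff)
    ultimately have "x - y = 0 \<or> x + y = 0"
      using dvd_imp_le_int[of "x - y" "int p"] dvd_imp_le_int[of "x + y" "int p"] by linarith
    then show ?thesis
      using xy by auto
  qed
  have inj: "inj_on ?f ?I" "inj_on ?g ?I"
  proof -
    show "inj_on ?f ?I"
    proof (rule inj_onI)
      fix x y assume xy: "x \<in> ?I" "y \<in> ?I" "?f x = ?f y"
      show "x = y"
        by (rule eq[OF xy(1,2)]) (use xy(3) in \<open>simp only: mod_eq_dvd_iff\<close>)
    qed
    show "inj_on ?g ?I"
    proof (rule inj_onI)
      fix x y assume xy: "x \<in> ?I" "y \<in> ?I" "?g x = ?g y"
      then have "int p dvd y * y - x * x"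
        by (simp add: mod_eq_dvd_iff)
      then show "x = y"
        by (rule eq[OF xy(2,1), symmetric])
    qed
  qed
  have "?f ` ?I \<inter> ?g ` ?I \<noteq> {}"
  proof
    assume "?f ` ?I \<inter> ?g ` ?I = {}"
    then have "card (?f ` ?I \<union> ?g ` ?I) = 2 * (m + 1)"
      by (subst card_Un_disjoint) (simp_all add: card_image inj)
    moreover have "card (?f ` ?I \<union> ?g ` ?I) \<le> card {0..<int p}"
      using m by (intro card_mono) auto
    ultimately show False
      using m by simp
  qed
  then obtain z where "z \<in> ?f ` ?I" "z \<in> ?g ` ?I"
    by blast
  then obtain x y where "?f x = ?g y"
    by (elim imageE) (rule that, simp only:)
  then have "(x * x + y * y) mod int p = ((- 1 - y * y) + y * y) mod int p"
    by (rule mod_add_cong) simp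
  then show ?thesis
    using that[of x y] by simp
qed

lemma quaternion_field_residue:
  assumes p: "Factorial_Ring.prime p" "odd p" and ab: "(a * a + b * b) mod int p = - 1 mod int p"
  shows "quaternion_field (range (residue p)) (residue p 1) (residue p a) (residue p b)"
proof
  have p0: "p > 0"
    using p prime_gt_0_nat by blast
  have p2: "p > 2"
    using p prime_ge_2_nat[of p] by (cases "p = 2") auto
  show "finite (range (residue p))"
    using p0 by (simp add: range_residue)
  show "0 \<in> range (residue p)"
    by (metis residue_0 rangeI)
  show "residue p 1 + residue p 1 \<noteq> 0"
    using p2 residue_eq_iff[of p 2 0] by (auto simp: residue_add residue_0)
  show "residue p a * residue p a + residue p b * residue p b = - residue p 1"
    using ab by (simp add: residue_mult residue_add residue_uminus residue_eq_iff)
  fix x assume "x \<in> range (residue p)"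
  then obtain c where x: "x = residue p c" by blast
  show "- x \<in> range (residue p)"
    by (simp add: x residue_uminus)
  show "residue p 1 * x = x"
    by (simp add: x residue_mult)
  have "x = residue p (int (nat (c mod int p)))"
    using p0 by (simp add: x residue_eq_iff)
  then show "\<exists>n. x = of_nat n * residue p 1"
    unfolding residue_of_nat by blast
  show "\<exists>y\<in>range (residue p). x * y = residue p 1" if "x \<noteq> 0"
  proof -
    have "\<not> int p dvd c"
      using that residue_eq_iff[of p c 0] by (auto simp: x residue_0 mod_eq_0_iff_dvd)
    then have "coprime c (int p)"
      using prime_imp_coprime[of "int p" c] p(1) by (simp add: coprime_commute)
    then obtain d k where "d * c + k * int p = 1"
      using bezout_int[of c "int p"] by auto
    then have "c * d mod int p = 1 mod int p"
      by (metis mod_mult_self1 mult.commute)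
    then have "x * residue p d = residue p 1"
      by (simp add: x residue_mult residue_eq_iff)
    then show ?thesis
      by blast
  qed
  fix y assume "y \<in> range (residue p)"
  then obtain d where y: "y = residue p d" by blast
  show "x + y \<in> range (residue p)" "x * y \<in> range (residue p)"
    by (simp_all add: x y residue_add residue_mult)
qed auto

section \<open>Transport along isomorphisms\<close>

text \<open>Injectivity keeps proper subgroups proper and distinct members distinct. The lemma
  serves in both directions: for the constructed covering and for pulling back an arbitrary
  one.\<close>

lemma two_covering_iso:
  assumes G: "group G" and H: "group H" and f: "f \<in> Group.iso G H" and C: "two_covering G C"
  shows "two_covering H ((`) f ` C)" "card ((`) f ` C) = card C"
proof -
  have "f \<in> hom G H"
    using f by (simp add: Group.iso_def)
  then interpret group_hom G H f
    by (intro group_hom.intro group_hom_axioms.intro G H)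
  have inj: "inj_on f (carrier G)" and img: "f ` carrier G = carrier H"
    using f by (auto simp: Group.iso_def bij_betw_def)
  have sub: "subgroup K G" "K \<noteq> carrier G" if "K \<in> C" for K
    using C that unfolding two_covering_def by blast+
  have incl: "K \<subseteq> carrier G" if "K \<in> C" for K
    by (rule subgroup.subset[OF sub(1)[OF that]])
  show "two_covering H ((`) f ` C)"
    unfolding two_covering_def
  proof (intro conjI ballI)
    fix L assume "L \<in> (`) f ` C"
    then obtain K where K: "K \<in> C" "L = f ` K" by blast
    show "subgroup L H"
      unfolding K(2) by (rule subgroup_img_is_subgroup[OF sub(1)[OF K(1)]])
    show "L \<noteq> carrier H"
      using inj_on_image_eq_iff[OF inj incl[OF K(1)] subset_refl] sub(2)[OF K(1)]
      unfolding K(2) img by blast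
  next
    fix x y assume "x \<in> carrier H" "y \<in> carrier H"
    then obtain x' y' where xy: "x' \<in> carrier G" "y' \<in> carrier G" "x = f x'" "y = f y'"
      unfolding img[symmetric] by blast
    then obtain K where "K \<in> C" "x' \<in> K" "y' \<in> K"
      using C unfolding two_covering_def by blast
    then show "\<exists>L\<in>(`) f ` C. x \<in> L \<and> y \<in> L"
      using xy by blast
  qed
  have "inj_on ((`) f) C"
    using inj_on_image_Pow[OF inj] by (rule inj_on_subset) (use incl in blast)
  then show "card ((`) f ` C) = card C"
    by (rule card_image)
qed

text \<open>Renaming the elements by natural numbers moves the constructed group to the type
  \<open>nat monoid\<close>.\<close>

lemma finite_group_iso_nat:
  assumes "group G" "finite (carrier G)"
  obtains H :: "nat monoid" and f where "group H" "f \<in> Group.iso G H"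
proof -
  interpret group G by fact
  obtain f :: "_ \<Rightarrow> nat" where inj: "inj_on f (carrier G)"
    using finite_imp_inj_to_nat_seg[OF assms(2)] by blast
  let ?g = "inv_into (carrier G) f"
  define H where "H = \<lparr>carrier = f ` carrier G, monoid.mult = \<lambda>x y. f (?g x \<otimes>\<^bsub>G\<^esub> ?g y), one = f \<one>\<^bsub>G\<^esub>\<rparr>"
  have hom: "f \<in> hom G H"
    using inj by (auto simp: hom_def H_def)
  have "group (H\<lparr>carrier := f ` carrier G, one := f \<one>\<^bsub>G\<^esub>\<rparr>)"
    by (rule hom_imp_img_group[OF hom])
  also have "H\<lparr>carrier := f ` carrier G, one := f \<one>\<^bsub>G\<^esub>\<rparr> = H"
    by (simp add: H_def)
  finally have "group H" .
  moreover have "f \<in> Group.iso G H"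
    using hom inj by (simp add: Group.iso_def bij_betw_def H_def)
  ultimately show ?thesis
    by (rule that)
qed

lemma sigma2_eqI:
  assumes "two_covering G C" "finite C" "card C = n"
    and "\<And>C'. two_covering G C' \<Longrightarrow> finite C' \<Longrightarrow> n \<le> card C'"
  shows "sigma2 G = n"
  unfolding sigma2_def using assms by (intro Least_equality) blast+

theorem theorem1:
  fixes p :: nat
  assumes "Factorial_Ring.prime p" and "odd p"
  shows "\<exists>G :: nat monoid. group G \<and> finite (carrier G) \<and> solvable G \<and>
           (\<exists>C. two_covering G C) \<and>
           sigma2 G = 1 + p^2 + p^3 + p^4"
proof -
  obtain a b :: int where ab: "(a * a + b * b) mod int p = - 1 mod int p"
    using minus_one_sum_of_two_squares_mod[OF assms] by blast
  interpret quaternion_field "range (residue p)" "residue p 1" "residue p a" "residue p b"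
    by (rule quaternion_field_residue[OF assms ab])
  have card_F: "card (range (residue p)) = p"
    using assms(1) prime_gt_0_nat by (intro card_range_residue) blast
  obtain H :: "nat monoid" and f where H: "group H" and f: "f \<in> Group.iso G H"
    using finite_group_iso_nat[OF group_G finite_G] by blast
  define C where "C = (`) f ` minimal_cover"
  have C: "two_covering H C" "card C = 1 + p^2 + p^3 + p^4"
    unfolding C_def using two_covering_iso[OF group_G H f two_covering_minimal_cover]
    by (simp_all only: card_minimal_cover card_F)
  have "sigma2 H = 1 + p^2 + p^3 + p^4"
  proof (rule sigma2_eqI[OF C(1) _ C(2)])
    show "finite C"
      using finite_minimal_cover by (simp add: C_def)
    fix C' assume C': "two_covering H C'" "finite C'"
    \<comment> \<open>The lower bound is known for the matrix group, so \<open>C'\<close> is carried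
      back there along the inverse isomorphism without changing its size.\<close>
    let ?g = "inv_into (carrier G) f"
    have g: "?g \<in> Group.iso H G"
      by (rule group.iso_set_sym[OF group_G f])
    from minimal_cover_le[OF two_covering_iso(1)[OF H group_G g C'(1)]] C'(2)
    show "1 + p^2 + p^3 + p^4 \<le> card C'"
      by (simp only: two_covering_iso(2)[OF H group_G g C'(1)] card_F finite_imageI)
  qed
  moreover have "f ` carrier G = carrier H" "group_hom G H f"
    using f group_G H by (simp_all add: Group.iso_def bij_betw_def group_hom_def group_hom_axioms_def)
  then have "finite (carrier H)" "solvable H"
    using finite_G group_hom.surj_hom_imp_solvable solvable_G by (metis finite_imageI, blast)
  ultimately show ?thesis
    using H C(1) by blast
qed

end
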